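(* Let $D\subset\mathbb{C}$ be an open set. For every $f\in\mathcal{O}(D\times D)$, $$T f(z,t)=\sum_{\ell=0}^{\infty}\frac{t^{\ell}}{\ell!}\,R_{\ell}f(z)$$ for all $(z,t)\in U_D$, where $R_\ell$ ($\ell\in\mathbb{N}$) are the Rankin--Cohen brackets $$R_{\ell}f(z)=\sum_{j=0}^{\ell}(-1)^j\binom{\ell}{j}^2\left.\frac{\partial^{\ell}f(\zeta_1,\zeta_2)}{\partial\zeta_1^{\ell-j}\,\partial\zeta_2^{j}}\right|_{\zeta_1=\zeta_2=z}.$$
   Context: $\mathbb{N}=\{0,1,2,\dots\}$; $\mathcal{O}(\cdot)$ denotes the space of holomorphic functions. For an open set $D\subset\mathbb{C}$ and $z\in D$, $d(z,\partial D)$ is the distance from $z$ to the boundary of $D$ ($=\infty$ if $D=\mathbb{C}$), and $$U_D:=\{(z,t)\in D\times\mathbb{C}:\ 2|t|<d(z,\partial D)\}.$$ For $f\in\mathcal{O}(D\times D)$ and $(z,t)\in U_D$ define $$(Tf)(z,t):=\frac{1}{(2\pi\sqrt{-1})^2}\oint_{C_1}\oint_{C_2}\frac{f(\zeta_1,\zeta_2)}{(\zeta_1-z)(\zeta_2-z)+t(\zeta_1-\zeta_2)}\,d\zeta_1\,d\zeta_2,$$ where $C_1=C_2$ is the positively oriented circle centred at $z$ of radius $r$ with $2|t|<r<d(z,\partial D)$ (the denominator does not vanish on $C_1\times C_2$, and the value does not depend on $r$). *)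

theory Defs
  imports "HOL-Complex_Analysis.Complex_Analysis"
begin

text \<open>
  Holomorphy in two variables is joint complex differentiability: the Frechet derivative
  exists and is complex linear. The sets of interest are open, where ``within'' plays no role.
\<close>

definition holomorphic2_on :: "(complex \<times> complex \<Rightarrow> complex) \<Rightarrow> (complex \<times> complex) set \<Rightarrow> bool"
    (infixl "holomorphic2'_on" 50) where
  "f holomorphic2_on S \<longleftrightarrow>
     (\<forall>p\<in>S. \<exists>a b. (f has_derivative (\<lambda>(h, k). a * h + b * k)) (at p within S))"

text \<open>
  Extended reals are used so that the infimum over the empty boundary of the whole plane
  is infinite (whereas \<^const>\<open>infdist\<close> would give 0).
\<close>

definition boundary_dist :: "complex \<Rightarrow> complex set \<Rightarrow> ereal" where
  "boundary_dist z D = (INF w\<in>frontier D. ereal (dist z w))"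

definition U_dom :: "complex set \<Rightarrow> (complex \<times> complex) set" where
  "U_dom D = {(z, t). z \<in> D \<and> ereal (2 * cmod t) < boundary_dist z D}"

text \<open>
  The radius \<open>r\<close> of the circles is a parameter. It is admissible for \<open>(z, t)\<close> if
  \<open>2 * cmod t < r\<close> and \<open>ereal r < boundary_dist z D\<close>.
\<close>

definition T_op :: "real \<Rightarrow> (complex \<times> complex \<Rightarrow> complex) \<Rightarrow> complex \<Rightarrow> complex \<Rightarrow> complex" where
  "T_op r f z t =
     1 / (2 * of_real pi * \<i>)\<^sup>2 *
     contour_integral (circlepath z r) (\<lambda>\<zeta>1.
       contour_integral (circlepath z r) (\<lambda>\<zeta>2.
         f (\<zeta>1, \<zeta>2) / ((\<zeta>1 - z) * (\<zeta>2 - z) + t * (\<zeta>1 - \<zeta>2))))"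

definition partial_deriv2 ::
    "nat \<Rightarrow> nat \<Rightarrow> (complex \<times> complex \<Rightarrow> complex) \<Rightarrow> complex \<times> complex \<Rightarrow> complex" where
  "partial_deriv2 m n f p =
     (deriv ^^ m) (\<lambda>\<zeta>1. (deriv ^^ n) (\<lambda>\<zeta>2. f (\<zeta>1, \<zeta>2)) (snd p)) (fst p)"

definition rankin_cohen :: "nat \<Rightarrow> (complex \<times> complex \<Rightarrow> complex) \<Rightarrow> complex \<Rightarrow> complex" where
  "rankin_cohen l f z =
     (\<Sum>j=0..l. (-1) ^ j * of_nat ((l choose j)\<^sup>2) * partial_deriv2 (l - j) j f (z, z))"

end

theory Submission
  imports Defs
begin

text \<open>
  Put \<open>a = \<zeta>1 - z\<close> and \<open>b = \<zeta>2 - z\<close>. On the torus \<open>|a| = |b| = r\<close> we have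
  \<open>|t (a - b) / (a b)| \<le> 2 |t| / r < 1\<close>, so the kernel \<open>1 / (a b + t (a - b))\<close> is the uniformly
  convergent sum of the terms \<open>(-t)^l (a - b)^l / (a b)^(l + 1)\<close>. Expanding \<open>(a - b)^l\<close> binomially and
  integrating against \<open>f\<close>, Cauchy's formula in each variable turns \<open>1 / (a^(l - j + 1) b^(j + 1))\<close>
  into the derivative of order \<open>(l - j, j)\<close> divided by \<open>(l - j)! j!\<close>; since
  \<open>(l choose j) / ((l - j)! j!) = (l choose j)\<^sup>2 / l!\<close>, this is the Rankin--Cohen bracket.
\<close>

section \<open>Iterated integrals over the torus: continuity, linearity, bounds, limits\<close>

text \<open>An iterated integral in the order used by \<open>T_op\<close>. Taking one function of a
  pair as integrand lets continuity and uniform convergence be stated jointly on the torus.\<close>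

definition torus_integral :: "complex \<Rightarrow> real \<Rightarrow> (complex \<times> complex \<Rightarrow> complex) \<Rightarrow> complex" where
  "torus_integral z r h =
     contour_integral (circlepath z r) (\<lambda>w. contour_integral (circlepath z r) (\<lambda>u. h (w, u)))"

text \<open>Pulled back to the unit interval, this is an integral over a fixed compact interval
  whose integrand is jointly continuous in point and parameter. It makes the outer of two iterated
  integrals exist.\<close>

lemma continuous_on_contour_integral_circlepath:
  assumes "0 < r" and cont: "continuous_on (S \<times> sphere z r) h"
  shows "continuous_on S (\<lambda>w. contour_integral (circlepath z r) (\<lambda>u. h (w, u)))"
proof -
  have mem: "circlepath z r x \<in> sphere z r" for x
    using \<open>0 < r\<close> by (simp add: circlepath dist_norm norm_mult)
  have "continuous_on (S \<times> cbox 0 1)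
          (\<lambda>p. h (fst p, circlepath z r (snd p)) * vector_derivative (circlepath z r) (at (snd p)))"
    unfolding vector_derivative_circlepath
    by (intro continuous_intros continuous_on_compose2[OF cont])
      (use mem in \<open>auto simp: circlepath intro!: continuous_intros\<close>)
  then have "continuous_on S (\<lambda>w. integral (cbox 0 1)
          (\<lambda>x. h (w, circlepath z r x) * vector_derivative (circlepath z r) (at x)))"
    by (intro integral_continuous_on_param) (simp add: case_prod_unfold)
  then show ?thesis
    by (simp add: contour_integral_integral)
qed

lemma continuous_on_section:
  assumes "continuous_on (S \<times> T) h" and "w \<in> S"
  shows "continuous_on T (\<lambda>u. h (w, u))"
  by (rule continuous_on_compose2[OF assms(1)]) (use assms(2) in \<open>auto intro!: continuous_intros\<close>)

lemma contour_integrable_torus_inner: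
  assumes "0 < r" and "continuous_on (sphere z r \<times> sphere z r) h" and "w \<in> sphere z r"
  shows "(\<lambda>u. h (w, u)) contour_integrable_on circlepath z r"
  using \<open>0 < r\<close> continuous_on_section[OF assms(2,3)]
  by (intro contour_integrable_continuous_circlepath) simp

lemma contour_integrable_torus_outer:
  assumes "0 < r" and "continuous_on (sphere z r \<times> sphere z r) h"
  shows "(\<lambda>w. contour_integral (circlepath z r) (\<lambda>u. h (w, u))) contour_integrable_on circlepath z r"
  using assms
  by (intro contour_integrable_continuous_circlepath continuous_on_contour_integral_circlepath) auto

lemma torus_integral_cong:
  assumes "0 < r" and "\<And>w u. w \<in> sphere z r \<Longrightarrow> u \<in> sphere z r \<Longrightarrow> g (w, u) = h (w, u)"
  shows "torus_integral z r g = torus_integral z r h"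
  unfolding torus_integral_def by (intro contour_integral_eq) (use assms in auto)

lemma torus_integral_sum:
  assumes "0 < r" and "finite A"
    and "\<And>i. i \<in> A \<Longrightarrow> continuous_on (sphere z r \<times> sphere z r) (h i)"
  shows "torus_integral z r (\<lambda>p. \<Sum>i\<in>A. h i p) = (\<Sum>i\<in>A. torus_integral z r (h i))"
proof -
  have "torus_integral z r (\<lambda>p. \<Sum>i\<in>A. h i p) = contour_integral (circlepath z r)
      (\<lambda>w. \<Sum>i\<in>A. contour_integral (circlepath z r) (\<lambda>u. h i (w, u)))"
    unfolding torus_integral_def
    by (intro contour_integral_eq contour_integral_sum)
      (use assms in \<open>auto intro: contour_integrable_torus_inner\<close>)
  also have "\<dots> = (\<Sum>i\<in>A. torus_integral z r (h i))"
    unfolding torus_integral_def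
    by (intro contour_integral_sum) (use assms in \<open>auto intro: contour_integrable_torus_outer\<close>)
  finally show ?thesis .
qed

lemma torus_integral_cmult:
  assumes "0 < r" and "continuous_on (sphere z r \<times> sphere z r) h"
  shows "torus_integral z r (\<lambda>p. c * h p) = c * torus_integral z r h"
proof -
  have "torus_integral z r (\<lambda>p. c * h p) = contour_integral (circlepath z r)
      (\<lambda>w. c * contour_integral (circlepath z r) (\<lambda>u. h (w, u)))"
    unfolding torus_integral_def
    by (intro contour_integral_eq contour_integral_lmul)
      (use assms in \<open>auto intro: contour_integrable_torus_inner\<close>)
  also have "\<dots> = c * torus_integral z r h"
    unfolding torus_integral_def
    by (intro contour_integral_lmul) (use assms in \<open>auto intro: contour_integrable_torus_outer\<close>)
  finally show ?thesis .
qed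

lemma torus_integral_diff:
  assumes "0 < r" and "continuous_on (sphere z r \<times> sphere z r) g"
    and "continuous_on (sphere z r \<times> sphere z r) h"
  shows "torus_integral z r (\<lambda>p. g p - h p) = torus_integral z r g - torus_integral z r h"
proof -
  have "torus_integral z r (\<lambda>p. g p - h p) = contour_integral (circlepath z r)
      (\<lambda>w. contour_integral (circlepath z r) (\<lambda>u. g (w, u))
         - contour_integral (circlepath z r) (\<lambda>u. h (w, u)))"
    unfolding torus_integral_def
    by (intro contour_integral_eq contour_integral_diff)
      (use assms in \<open>auto intro: contour_integrable_torus_inner\<close>)
  also have "\<dots> = torus_integral z r g - torus_integral z r h"
    unfolding torus_integral_def
    by (intro contour_integral_diff) (use assms in \<open>auto intro: contour_integrable_torus_outer\<close>)
  finally show ?thesis .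
qed

text \<open>The estimate by the length \<open>2 * pi * r\<close> of the circle is applied once in
  each variable, hence the square.\<close>

lemma norm_torus_integral_le:
  assumes "0 < r" and cont: "continuous_on (sphere z r \<times> sphere z r) h" and "0 \<le> B"
    and B: "\<And>w u. w \<in> sphere z r \<Longrightarrow> u \<in> sphere z r \<Longrightarrow> norm (h (w, u)) \<le> B"
  shows "norm (torus_integral z r h) \<le> B * (2 * pi * r)\<^sup>2"
proof -
  have sph: "x \<in> sphere z r" if "norm (x - z) = r" for x
    using that by (simp add: dist_norm norm_minus_commute)
  have inner: "norm (contour_integral (circlepath z r) (\<lambda>u. h (w, u))) \<le> B * (2 * pi * r)"
    if "w \<in> sphere z r" for w
    using that sph assms
    by (intro has_contour_integral_bound_circlepath
        [OF has_contour_integral_integral[OF contour_integrable_torus_inner[OF \<open>0 < r\<close> cont that]]])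
      auto
  have "norm (torus_integral z r h) \<le> B * (2 * pi * r) * (2 * pi * r)"
    unfolding torus_integral_def
    using sph inner assms
    by (intro has_contour_integral_bound_circlepath
        [OF has_contour_integral_integral[OF contour_integrable_torus_outer[OF \<open>0 < r\<close> cont]]])
      auto
  then show ?thesis
    by (simp add: power2_eq_square mult.assoc)
qed

lemma torus_integral_uniform_limit:
  assumes "0 < r" and cont: "\<And>n. continuous_on (sphere z r \<times> sphere z r) (h n)"
    and lim: "uniform_limit (sphere z r \<times> sphere z r) h g sequentially"
  shows "(\<lambda>n. torus_integral z r (h n)) \<longlonglongrightarrow> torus_integral z r g"
proof (rule tendstoI)
  fix e :: real
  assume "0 < e"
  have contg: "continuous_on (sphere z r \<times> sphere z r) g"
    using cont by (intro uniform_limit_theorem[OF _ lim]) auto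
  \<comment> \<open>With this choice \<open>d * (2 * pi * r)\<^sup>2\<close> is
    \<open>e / 2\<close>, strictly below \<open>e\<close>.\<close>
  define d where "d = e / (2 * (2 * pi * r)\<^sup>2)"
  have "0 < d"
    using \<open>0 < e\<close> \<open>0 < r\<close> by (simp add: d_def)
  have "eventually (\<lambda>n. \<forall>p\<in>sphere z r \<times> sphere z r. dist (h n p) (g p) < d) sequentially"
    using uniform_limitD[OF lim \<open>0 < d\<close>] .
  then show "eventually (\<lambda>n. dist (torus_integral z r (h n)) (torus_integral z r g) < e) sequentially"
  proof eventually_elim
    case (elim n)
    have "norm (torus_integral z r (\<lambda>p. h n p - g p)) \<le> d * (2 * pi * r)\<^sup>2"
    proof (rule norm_torus_integral_le)
      show "norm (h n (w, u) - g (w, u)) \<le> d" if "w \<in> sphere z r" "u \<in> sphere z r" for w u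
        using bspec[OF elim, of "(w, u)"] that by (simp add: dist_norm less_imp_le)
    qed (use \<open>0 < r\<close> \<open>0 < d\<close> cont contg in \<open>auto intro!: continuous_intros\<close>)
    also have "d * (2 * pi * r)\<^sup>2 < e"
      using \<open>0 < e\<close> \<open>0 < r\<close> by (simp add: d_def)
    finally show ?case
      using torus_integral_diff[OF \<open>0 < r\<close> cont contg] by (simp add: dist_norm)
  qed
qed

text \<open>The majorant \<open>M\<close> makes the partial sums converge uniformly on the torus, so
  summation and integration may be interchanged.\<close>

lemma torus_integral_sums:
  assumes "0 < r" and cont: "\<And>n. continuous_on (sphere z r \<times> sphere z r) (h n)"
    and M: "\<And>n p. p \<in> sphere z r \<times> sphere z r \<Longrightarrow> norm (h n p) \<le> M n" "summable M"
  shows "(\<lambda>n. torus_integral z r (h n)) sums torus_integral z r (\<lambda>p. \<Sum>n. h n p)"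
proof -
  have "uniform_limit (sphere z r \<times> sphere z r) (\<lambda>n p. \<Sum>i<n. h i p) (\<lambda>p. \<Sum>n. h n p) sequentially"
    using M by (rule Weierstrass_m_test)
  then have "(\<lambda>n. torus_integral z r (\<lambda>p. \<Sum>i<n. h i p))
      \<longlonglongrightarrow> torus_integral z r (\<lambda>p. \<Sum>n. h n p)"
    using assms by (intro torus_integral_uniform_limit) (auto intro!: continuous_intros)
  then show ?thesis
    using assms by (simp add: sums_def torus_integral_sum)
qed

section \<open>Holomorphic dependence on a parameter and Cauchy's formula on the torus\<close>

text \<open>
  The parameter integral reproduces itself under Cauchy's formula once the two integrations are
  interchanged; it is therefore itself a Cauchy integral.
\<close>

lemma holomorphic_contour_integral_circlepath:
  assumes "0 < r" and cont: "continuous_on (cball z r \<times> sphere z r) h"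
    and hol: "\<And>u. u \<in> sphere z r \<Longrightarrow> (\<lambda>w. h (w, u)) holomorphic_on ball z r"
  shows "(\<lambda>w. contour_integral (circlepath z r) (\<lambda>u. h (w, u))) holomorphic_on ball z r"
proof -
  define G where "G = (\<lambda>w. contour_integral (circlepath z r) (\<lambda>u. h (w, u)))"
  have contG: "continuous_on (sphere z r) G"
    unfolding G_def using \<open>0 < r\<close> cont
    by (intro continuous_on_contour_integral_circlepath) (auto elim: continuous_on_subset)
  have contd: "continuous_on {0..1} (\<lambda>t. vector_derivative (circlepath z r) (at t))"
    by (auto simp: vector_derivative_circlepath intro!: continuous_intros)
  \<comment> \<open>The exponent 1 is the one at which the differentiation rule for Cauchy-type
    integrals is applied below.\<close>
  have "((\<lambda>v. G v / (v - w) ^ 1) has_contour_integral 2 * of_real pi * \<i> * G w) (circlepath z r)"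
    if w: "w \<in> ball z r" for w
  proof -
    have ne: "v \<noteq> w" if "v \<in> sphere z r" for v
      using that w by auto
    \<comment> \<open>As \<open>w\<close> lies inside the circle, the Cauchy kernel has no pole on
      it; joint continuity on the torus permits the interchange of the two integrals.\<close>
    have cont': "continuous_on (sphere z r \<times> sphere z r) (\<lambda>p. h p / (fst p - w))"
      by (intro continuous_intros continuous_on_subset[OF cont]) (use ne in auto)
    have "(\<lambda>v. G v / (v - w)) contour_integrable_on circlepath z r"
      using \<open>0 < r\<close> ne contG
      by (intro contour_integrable_continuous_circlepath continuous_intros) auto
    moreover have "contour_integral (circlepath z r) (\<lambda>v. G v / (v - w)) = 2 * of_real pi * \<i> * G w"
    proof -
      have "contour_integral (circlepath z r) (\<lambda>v. G v / (v - w)) =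
          contour_integral (circlepath z r)
            (\<lambda>v. contour_integral (circlepath z r) (\<lambda>u. h (v, u) / (v - w)))"
        unfolding G_def
      proof (intro contour_integral_eq contour_integral_div [symmetric])
        fix v assume "v \<in> path_image (circlepath z r)"
        then show "(\<lambda>u. h (v, u)) contour_integrable_on circlepath z r"
          using \<open>0 < r\<close>
          by (intro contour_integrable_torus_inner continuous_on_subset[OF cont]) auto
      qed
      also have "\<dots> = contour_integral (circlepath z r)
            (\<lambda>u. contour_integral (circlepath z r) (\<lambda>v. h (v, u) / (v - w)))"
        using \<open>0 < r\<close> cont' contd by (intro contour_integral_swap) (auto simp: case_prod_unfold)
      \<comment> \<open>Now the inner integral runs over the variable in which \<open>h\<close> is
        holomorphic, so Cauchy's formula evaluates it.\<close>
      also have "\<dots> = contour_integral (circlepath z r) (\<lambda>u. 2 * of_real pi * \<i> * h (w, u))"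
      proof (intro contour_integral_eq contour_integral_unique Cauchy_integral_circlepath)
        fix u assume "u \<in> path_image (circlepath z r)"
        then have u: "u \<in> sphere z r"
          using \<open>0 < r\<close> by simp
        show "continuous_on (cball z r) (\<lambda>v. h (v, u))"
          by (rule continuous_on_compose2[OF cont]) (use u in \<open>auto intro!: continuous_intros\<close>)
        show "(\<lambda>v. h (v, u)) holomorphic_on ball z r"
          using hol[OF u] .
      qed (use w in \<open>simp add: dist_norm norm_minus_commute\<close>)
      also have "\<dots> = 2 * of_real pi * \<i> * G w"
        unfolding G_def
      proof (intro contour_integral_lmul contour_integrable_continuous_circlepath)
        show "continuous_on (path_image (circlepath z r)) (\<lambda>u. h (w, u))"
          using \<open>0 < r\<close> w by (intro continuous_on_section[OF cont, THEN continuous_on_subset]) auto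
      qed
      finally show ?thesis .
    qed
    ultimately show ?thesis
      using has_contour_integral_integral by fastforce
  qed
  \<comment> \<open>Up to a constant, \<open>G\<close> inside the disc is the Cauchy integral of its
    continuous values on the circle, so it can be differentiated under the integral sign.\<close>
  then have "((\<lambda>w. 2 * of_real pi * \<i> * G w) has_field_derivative
        of_nat 1 * contour_integral (circlepath z r) (\<lambda>v. G v / (v - w) ^ Suc 1)) (at w)"
    if "w \<in> ball z r" for w
    using Cauchy_next_derivative_circlepath(2)[of z r G 1 "\<lambda>w. 2 * of_real pi * \<i> * G w" w]
      contG \<open>0 < r\<close> that by auto
  then have "(\<lambda>w. 2 * of_real pi * \<i> * G w) holomorphic_on ball z r"
    by (intro holomorphic_onI) (meson field_differentiable_at_within field_differentiable_def)
  then have "(\<lambda>w. 1 / (2 * of_real pi * \<i>) * (2 * of_real pi * \<i> * G w)) holomorphic_on ball z r"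
    by (rule holomorphic_on_mult[OF holomorphic_on_const])
  also have "(\<lambda>w. 1 / (2 * of_real pi * \<i>) * (2 * of_real pi * \<i> * G w)) = G"
    by auto
  finally show ?thesis
    by (simp add: G_def)
qed

text \<open>Cauchy's formula for derivatives is used in \<open>u\<close>, then in \<open>w\<close>
  for the function \<open>g\<close> of \<open>n\<close>-th derivatives at \<open>z\<close>. The
  second use needs \<open>g\<close> continuous on the closed disc and holomorphic inside; both are
  obtained from the integral \<open>G\<close>, a constant multiple of \<open>g\<close>.\<close>

lemma torus_integral_Cauchy:
  assumes "0 < r" and cont: "continuous_on (cball z r \<times> cball z r) f"
    and hol1: "\<And>u. u \<in> cball z r \<Longrightarrow> (\<lambda>w. f (w, u)) holomorphic_on ball z r"
    and hol2: "\<And>w. w \<in> cball z r \<Longrightarrow> (\<lambda>u. f (w, u)) holomorphic_on ball z r"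
  shows "torus_integral z r (\<lambda>(w, u). f (w, u) / ((w - z) ^ Suc m * (u - z) ^ Suc n)) =
         (2 * of_real pi * \<i>)\<^sup>2 / (fact m * fact n) * partial_deriv2 m n f (z, z)"
proof -
  define g where "g = (\<lambda>w. (deriv ^^ n) (\<lambda>u. f (w, u)) z)"
  define G where
    "G = (\<lambda>w. contour_integral (circlepath z r) (\<lambda>u. f (w, u) / (u - z) ^ Suc n))"
  have ne: "u \<noteq> z" if "u \<in> sphere z r" for u
    using that \<open>0 < r\<close> by auto
  have z: "z \<in> ball z r"
    using \<open>0 < r\<close> by simp
  have int: "((\<lambda>u. f (w, u) / (u - z) ^ Suc n) has_contour_integral
      2 * pi * \<i> / fact n * g w) (circlepath z r)" if "w \<in> cball z r" for w
    unfolding g_def using that cont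
    by (intro Cauchy_has_contour_integral_higher_derivative_circlepath hol2 z)
      (auto elim: continuous_on_section)
  have G: "G w = 2 * pi * \<i> / fact n * g w" if "w \<in> cball z r" for w
    unfolding G_def using int[OF that] by (rule contour_integral_unique)
  \<comment> \<open>Solving for \<open>g\<close> transfers the regularity of the parameter integral
    \<open>G\<close> to the derivative.\<close>
  then have g: "g w = fact n / (2 * pi * \<i>) * G w" if "w \<in> cball z r" for w
    using that by (simp add: field_simps)
  have cont': "continuous_on (cball z r \<times> sphere z r) (\<lambda>p. f p / (snd p - z) ^ Suc n)"
    by (intro continuous_intros continuous_on_subset[OF cont]) (use ne in auto)
  have "continuous_on (cball z r) G"
    unfolding G_def using continuous_on_contour_integral_circlepath[OF \<open>0 < r\<close> cont'] by simp
  then have contg: "continuous_on (cball z r) g"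
    using g by (subst continuous_on_cong[OF refl g]) (auto intro!: continuous_intros)
  have "G holomorphic_on ball z r"
    unfolding G_def
  proof (rule holomorphic_contour_integral_circlepath[OF \<open>0 < r\<close> cont', unfolded fst_conv snd_conv])
    fix u assume "u \<in> sphere z r"
    then show "(\<lambda>w. f (w, u) / (u - z) ^ Suc n) holomorphic_on ball z r"
      using ne hol1 by (intro holomorphic_intros) auto
  qed
  then have "(\<lambda>w. fact n / (2 * pi * \<i>) * G w) holomorphic_on ball z r"
    by (intro holomorphic_intros)
  then have holg: "g holomorphic_on ball z r"
    using g by (subst holomorphic_cong[OF refl g]) auto
  have "torus_integral z r (\<lambda>(w, u). f (w, u) / ((w - z) ^ Suc m * (u - z) ^ Suc n)) =
      contour_integral (circlepath z r) (\<lambda>w. 2 * pi * \<i> / fact n * (g w / (w - z) ^ Suc m))"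
    unfolding torus_integral_def
  proof (intro contour_integral_eq)
    fix w assume "w \<in> path_image (circlepath z r)"
    then have w: "w \<in> cball z r"
      using \<open>0 < r\<close> by auto
    show "contour_integral (circlepath z r)
            (\<lambda>u. case (w, u) of (w, u) \<Rightarrow> f (w, u) / ((w - z) ^ Suc m * (u - z) ^ Suc n)) =
          2 * pi * \<i> / fact n * (g w / (w - z) ^ Suc m)"
      \<comment> \<open>The power of \<open>w - z\<close> is constant for the inner
        integration.\<close>
      using has_contour_integral_div[OF int[OF w], of "(w - z) ^ Suc m"]
      by (intro contour_integral_unique) (simp add: mult_ac)
  qed
  also have "\<dots> = 2 * pi * \<i> / fact n * (2 * pi * \<i> / fact m * (deriv ^^ m) g z)"
    by (intro contour_integral_unique has_contour_integral_lmul
        Cauchy_has_contour_integral_higher_derivative_circlepath contg holg z)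
  finally show ?thesis
    by (simp add: g_def partial_deriv2_def power2_eq_square mult_ac)
qed

section \<open>Discs inside the domain and sections of functions of two variables\<close>

text \<open>A disc is connected: meeting both \<open>D\<close> and its complement, it would contain
  a frontier point, at distance at most \<open>r\<close> from \<open>z\<close>.\<close>

lemma cball_subset_boundary_dist:
  assumes "z \<in> D" and "ereal r < boundary_dist z D"
  shows "cball z r \<subseteq> D"
proof (rule ccontr)
  assume "\<not> cball z r \<subseteq> D"
  then obtain w where w: "w \<in> cball z r" "w \<notin> D"
    by blast
  \<comment> \<open>This puts the centre \<open>z\<close>, a point of \<open>D\<close>, into the
    disc.\<close>
  then have "0 \<le> r"
    by (metis dist_not_less_zero dual_order.trans linorder_not_le mem_cball)
  then have "cball z r \<inter> frontier D \<noteq> {}"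
    using w assms(1) by (intro connected_Int_frontier) (auto intro: centre_in_cball[THEN iffD2])
  then obtain v where v: "v \<in> cball z r" "v \<in> frontier D"
    by auto
  then have "boundary_dist z D \<le> ereal (dist z v)"
    unfolding boundary_dist_def by (intro INF_lower)
  also have "\<dots> \<le> ereal r"
    using v by simp
  finally show False
    using assms(2) by simp
qed

lemma holomorphic2_on_imp_continuous_on:
  "f holomorphic2_on S \<Longrightarrow> continuous_on S f"
  unfolding holomorphic2_on_def continuous_on_eq_continuous_within
  by (meson has_derivative_continuous)

text \<open>Chain rule along the embedding of a horizontal slice: its derivative sends
  \<open>h\<close> to \<open>(h, 0)\<close>, so the complex linear form reduces to multiplication by
  \<open>a\<close>.\<close>

lemma holomorphic2_on_section_fst:
  assumes "f holomorphic2_on (A \<times> B)" and "u \<in> B"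
  shows "(\<lambda>w. f (w, u)) holomorphic_on A"
proof (rule holomorphic_onI)
  fix w assume "w \<in> A"
  then obtain a b where
    ab: "(f has_derivative (\<lambda>(h, k). a * h + b * k)) (at (w, u) within A \<times> B)"
    using assms unfolding holomorphic2_on_def by blast
  have pair: "((\<lambda>w. (w, u)) has_derivative (\<lambda>h. (h, 0))) (at w within A)"
    by (auto intro!: derivative_eq_intros)
  have "((\<lambda>w. f (w, u)) has_derivative (\<lambda>h. a * h)) (at w within A)"
    using has_derivative_in_compose[OF pair has_derivative_subset[OF ab]] assms(2)
    by (auto simp: image_subset_iff)
  then show "(\<lambda>w. f (w, u)) field_differentiable at w within A"
    unfolding field_differentiable_def has_field_derivative_def by blast
qed

lemma holomorphic2_on_section_snd:
  assumes "f holomorphic2_on (A \<times> B)" and "w \<in> A"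
  shows "(\<lambda>u. f (w, u)) holomorphic_on B"
proof (rule holomorphic_onI)
  fix u assume "u \<in> B"
  then obtain a b where
    ab: "(f has_derivative (\<lambda>(h, k). a * h + b * k)) (at (w, u) within A \<times> B)"
    using assms unfolding holomorphic2_on_def by blast
  have pair: "((\<lambda>u. (w, u)) has_derivative (\<lambda>k. (0, k))) (at u within B)"
    by (auto intro!: derivative_eq_intros)
  have "((\<lambda>u. f (w, u)) has_derivative (\<lambda>k. b * k)) (at u within B)"
    using has_derivative_in_compose[OF pair has_derivative_subset[OF ab]] assms(2)
    by (auto simp: image_subset_iff)
  then show "(\<lambda>u. f (w, u)) field_differentiable at u within B"
    unfolding field_differentiable_def has_field_derivative_def by blast
qed

section \<open>Expansion of the kernel\<close>

text \<open>The binomial term with \<open>(- a) ^ j * b ^ (l - j)\<close> carries the sign;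
  cancelling it against \<open>(a * b) ^ Suc l\<close> leaves \<open>l - j + 1\<close> factors
  \<open>a\<close> and \<open>j + 1\<close> factors \<open>b\<close> in the denominator.\<close>

lemma kernel_term_expansion:
  fixes a b t :: complex
  assumes "a \<noteq> 0" and "b \<noteq> 0"
  shows "(- t * (a - b)) ^ l / (a * b) ^ Suc l =
         (\<Sum>j=0..l. t ^ l * ((-1) ^ j * of_nat (l choose j)) * (1 / (a ^ Suc (l - j) * b ^ Suc j)))"
proof -
  \<comment> \<open>The minus sign of \<open>- t\<close> is absorbed into the binomial, so that no
    factor of sign \<open>(-1) ^ l\<close> remains.\<close>
  have "(- t * (a - b)) ^ l = t ^ l * (- a + b) ^ l"
    by (simp flip: power_mult_distrib add: algebra_simps)
  also have "(- a + b) ^ l = (\<Sum>j=0..l. of_nat (l choose j) * (- a) ^ j * b ^ (l - j))"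
    by (simp only: binomial_ring atMost_atLeast0)
  finally have "(- t * (a - b)) ^ l / (a * b) ^ Suc l =
      (\<Sum>j=0..l. t ^ l * (of_nat (l choose j) * (- a) ^ j * b ^ (l - j)) / (a * b) ^ Suc l)"
    by (simp only: sum_distrib_left sum_divide_distrib)
  also have "\<dots> = (\<Sum>j=0..l. t ^ l * ((-1) ^ j * of_nat (l choose j)) *
      (1 / (a ^ Suc (l - j) * b ^ Suc j)))"
  proof (intro sum.cong refl)
    fix j assume "j \<in> {0..l}"
    then have split: "x ^ l = x ^ j * x ^ (l - j)" for x :: complex
      by (simp flip: power_add)
    show "t ^ l * (of_nat (l choose j) * (- a) ^ j * b ^ (l - j)) / (a * b) ^ Suc l =
        t ^ l * ((-1) ^ j * of_nat (l choose j)) * (1 / (a ^ Suc (l - j) * b ^ Suc j))"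
      using assms
      by (simp add: power_minus[of a] power_mult_distrib split[of a] split[of b] field_simps)
  qed
  finally show ?thesis .
qed

text \<open>Taking out \<open>1 / (a * b)\<close> leaves a geometric series in \<open>q\<close>. The
  bound on its terms depends on \<open>r\<close> and \<open>t\<close> but not on the point of the
  torus, as a Weierstrass majorant must.\<close>

lemma kernel_geometric_series:
  fixes a b t :: complex
  assumes "norm a = r" and "norm b = r" and "2 * norm t < r"
  shows "norm ((- t * (a - b)) ^ l / (a * b) ^ Suc l) \<le> (2 * norm t / r) ^ l / r\<^sup>2"
    and "(\<lambda>l. (- t * (a - b)) ^ l / (a * b) ^ Suc l) sums (1 / (a * b + t * (a - b)))"
proof -
  have "0 < r"
    using assms(3) norm_ge_zero[of t] by linarith
  then have ab: "a \<noteq> 0" "b \<noteq> 0"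
    using assms by auto
  define q where "q = - t * (a - b) / (a * b)"
  have eq: "(- t * (a - b)) ^ l / (a * b) ^ Suc l = q ^ l / (a * b)" for l
    unfolding q_def power_divide by simp
  have "norm q = norm t * norm (a - b) / r\<^sup>2"
    using assms by (simp add: q_def norm_mult norm_divide power2_eq_square)
  also have "\<dots> \<le> norm t * (2 * r) / r\<^sup>2"
    using assms norm_triangle_ineq4[of a b]
    by (intro divide_right_mono mult_left_mono) auto
  also have "\<dots> = 2 * norm t / r"
    using \<open>0 < r\<close> by (simp add: power2_eq_square field_simps)
  finally have q: "norm q \<le> 2 * norm t / r" .
  show "norm ((- t * (a - b)) ^ l / (a * b) ^ Suc l) \<le> (2 * norm t / r) ^ l / r\<^sup>2"
    unfolding eq using q assms
    by (simp add: norm_divide norm_mult norm_power power2_eq_square divide_right_mono power_mono)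
  have "norm q < 1"
    using q assms(3) \<open>0 < r\<close> by (smt (verit) divide_less_eq_1)
  then have "(\<lambda>l. q ^ l / (a * b)) sums (1 / (1 - q) / (a * b))"
    by (intro sums_divide geometric_sums)
  moreover have "1 / (1 - q) / (a * b) = 1 / ((1 - q) * (a * b))"
    by simp
  moreover have "(1 - q) * (a * b) = a * b + t * (a - b)"
    using ab by (simp add: q_def field_simps)
  ultimately show "(\<lambda>l. (- t * (a - b)) ^ l / (a * b) ^ Suc l) sums (1 / (a * b + t * (a - b)))"
    by (simp only: eq)
qed

text \<open>The origin of the squared binomial coefficient: one factor comes from the binomial
  expansion, the other from the factorials in Cauchy's formula.\<close>

lemma choose_div_fact:
  assumes "j \<le> l"
  shows "of_nat (l choose j) / (fact (l - j) * fact j) = (of_nat ((l choose j)\<^sup>2) / fact l :: complex)"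
  using binomial_fact[OF assms, where 'a = complex] by (simp add: power2_eq_square field_simps)

section \<open>The Rankin-Cohen expansion\<close>

text \<open>The terms do not mention \<open>r\<close>, so uniqueness of sums also shows that
  \<open>T_op\<close> takes the same value for all admissible radii.\<close>

theorem theorem2p3:
  fixes D :: "complex set" and f :: "complex \<times> complex \<Rightarrow> complex"
    and z t :: complex and r :: real
  assumes "open D"
    and "f holomorphic2_on (D \<times> D)"
    and "(z, t) \<in> U_dom D"
    and "2 * cmod t < r" and "ereal r < boundary_dist z D"
  shows "(\<lambda>l. t ^ l / fact l * rankin_cohen l f z) sums T_op r f z t"
proof -
  have "0 < r"
    using assms(4) norm_ge_zero[of t] by linarith
  have "z \<in> D"
    using assms(3) by (simp add: U_dom_def)
  then have sub: "cball z r \<subseteq> D"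
    using assms(5) by (rule cball_subset_boundary_dist)
  let ?S = "sphere z r"
  define c where "c = (2 * of_real pi * \<i>)\<^sup>2"
  have "c \<noteq> 0"
    by (simp add: c_def)
  have contf: "continuous_on (cball z r \<times> cball z r) f"
    using holomorphic2_on_imp_continuous_on[OF assms(2)] sub by (auto elim: continuous_on_subset)
  have hol1: "(\<lambda>w. f (w, u)) holomorphic_on ball z r" if "u \<in> cball z r" for u
    using holomorphic2_on_section_fst[OF assms(2), of u] that sub ball_subset_cball
    by (blast intro: holomorphic_on_subset)
  have hol2: "(\<lambda>u. f (w, u)) holomorphic_on ball z r" if "w \<in> cball z r" for w
    using holomorphic2_on_section_snd[OF assms(2), of w] that sub ball_subset_cball
    by (blast intro: holomorphic_on_subset)
  have contS: "continuous_on (?S \<times> ?S) f"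
    using contf by (rule continuous_on_subset) auto
  have ne: "u \<noteq> z" if "u \<in> ?S" for u
    using that \<open>0 < r\<close> by auto

  \<comment> \<open>\<open>h l\<close> is \<open>f\<close> times the \<open>l\<close>-th term of the
    geometric series for the kernel; \<open>k m n\<close> below is the integrand of Cauchy's
    formula.\<close>
  define h where "h = (\<lambda>l (w, u). f (w, u) *
      ((- t * ((w - z) - (u - z))) ^ l / ((w - z) * (u - z)) ^ Suc l))"
  define k where "k = (\<lambda>m n (w, u). f (w, u) / ((w - z) ^ Suc m * (u - z) ^ Suc n))"
  have conth: "continuous_on (?S \<times> ?S) (h l)" for l
    unfolding h_def case_prod_unfold prod.collapse
    by (intro continuous_intros contS) (use ne in auto)
  have contk: "continuous_on (?S \<times> ?S) (k m n)" for m n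
    unfolding k_def case_prod_unfold prod.collapse
    by (intro continuous_intros contS) (use ne in auto)

  \<comment> \<open>Compactness of the torus bounds \<open>f\<close> and so turns the majorant of
    the kernel terms into one for \<open>h\<close>.\<close>
  have "compact (f ` (?S \<times> ?S))"
    by (intro compact_continuous_image contS compact_Times compact_sphere)
  then obtain B where B: "\<And>p. p \<in> ?S \<times> ?S \<Longrightarrow> norm (f p) \<le> B" and "0 < B"
    by (metis bounded_pos compact_imp_bounded imageI)
  have norm_h: "norm (h l p) \<le> B * ((2 * norm t / r) ^ l / r\<^sup>2)" if "p \<in> ?S \<times> ?S" for l p
  proof -
    obtain w u where p: "p = (w, u)" "w \<in> ?S" "u \<in> ?S"
      using \<open>p \<in> ?S \<times> ?S\<close> by blast
    then have "norm (w - z) = r" "norm (u - z) = r"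
      by (auto simp: dist_norm norm_minus_commute)
    from kernel_geometric_series(1)[OF this assms(4), of l] B[OF that] show ?thesis
      unfolding h_def p(1) prod.case norm_mult[of "f _"]
      using \<open>0 < B\<close> by (intro mult_mono) auto
  qed
  have "summable (\<lambda>l. B * ((2 * norm t / r) ^ l / r\<^sup>2))"
    using assms(4) \<open>0 < r\<close> by (intro summable_mult summable_divide summable_geometric) simp
  with norm_h have "(\<lambda>l. torus_integral z r (h l)) sums torus_integral z r (\<lambda>p. \<Sum>l. h l p)"
    by (intro torus_integral_sums[OF \<open>0 < r\<close> conth])
  also have "torus_integral z r (\<lambda>p. \<Sum>l. h l p) =
      torus_integral z r (\<lambda>(w, u). f (w, u) / ((w - z) * (u - z) + t * (w - u)))"
  proof (rule torus_integral_cong[OF \<open>0 < r\<close>])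
    fix w u assume "w \<in> ?S" "u \<in> ?S"
    then have "norm (w - z) = r" "norm (u - z) = r"
      by (auto simp: dist_norm norm_minus_commute)
    from sums_mult[OF kernel_geometric_series(2)[OF this assms(4)], of "f (w, u)"]
    show "(\<Sum>l. h l (w, u)) = (case (w, u) of (w, u) \<Rightarrow>
        f (w, u) / ((w - z) * (u - z) + t * (w - u)))"
      by (simp add: h_def sums_iff)
  qed
  \<comment> \<open>The factor \<open>c\<close> undoes the normalisation in \<open>T_op\<close>; it
    reappears from Cauchy's formula in every term and cancels.\<close>
  also have "\<dots> = c * T_op r f z t"
    using \<open>c \<noteq> 0\<close> by (simp add: T_op_def torus_integral_def flip: c_def)
  finally have "(\<lambda>l. torus_integral z r (h l) / c) sums (c * T_op r f z t / c)"
    by (rule sums_divide)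
  \<comment> \<open>For fixed \<open>l\<close> the sum over \<open>j\<close> is finite, so linearity
    reduces the integral to those of \<open>k (l - j) j\<close>.\<close>
  moreover have "torus_integral z r (h l) / c = t ^ l / fact l * rankin_cohen l f z" for l
  proof -
    have "torus_integral z r (h l) = torus_integral z r
        (\<lambda>p. \<Sum>j=0..l. t ^ l * ((-1) ^ j * of_nat (l choose j)) * k (l - j) j p)"
    proof (rule torus_integral_cong[OF \<open>0 < r\<close>])
      fix w u assume "w \<in> ?S" "u \<in> ?S"
      then have "w - z \<noteq> 0" "u - z \<noteq> 0"
        using ne by auto
      then show "h l (w, u) = (\<Sum>j=0..l. t ^ l * ((-1) ^ j * of_nat (l choose j)) * k (l - j) j (w, u))"
        unfolding h_def k_def prod.case
        by (subst kernel_term_expansion) (simp_all add: sum_distrib_left mult_ac)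
    qed
    also have "\<dots> = (\<Sum>j=0..l. t ^ l * ((-1) ^ j * of_nat (l choose j)) *
        torus_integral z r (k (l - j) j))"
      using \<open>0 < r\<close> contk
      by (simp add: torus_integral_sum torus_integral_cmult continuous_on_mult_left)
    also have "\<dots> = (\<Sum>j=0..l. c * (t ^ l * ((-1) ^ j *
        (of_nat (l choose j) / (fact (l - j) * fact j)) * partial_deriv2 (l - j) j f (z, z))))"
      unfolding k_def
      by (simp only: torus_integral_Cauchy[OF \<open>0 < r\<close> contf hol1 hol2] c_def[symmetric])
        (simp add: mult_ac)
    also have "\<dots> = (\<Sum>j=0..l. c * (t ^ l * ((-1) ^ j *
        (of_nat ((l choose j)\<^sup>2) / fact l) * partial_deriv2 (l - j) j f (z, z))))"
      by (intro sum.cong refl) (simp only: choose_div_fact atLeastAtMost_iff)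
    also have "\<dots> = c * (t ^ l / fact l * rankin_cohen l f z)"
      by (simp add: rankin_cohen_def sum_distrib_left mult_ac)
    finally show ?thesis
      using \<open>c \<noteq> 0\<close> by simp
  qed
  ultimately show ?thesis
    using \<open>c \<noteq> 0\<close> by simp
qed

end
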